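(* Let $R$ be a confluent EPRF-TRS over a ranked alphabet $\Sigma$ and let $p,q\in T_\Sigma(X)$. Then it is decidable whether $p\Leftrightarrow^*_R q$.
   Context: A ranked alphabet $\Sigma$ is a finite set of symbols with ranks; $X=\{x_1,x_2,\dots\}$ is a countable set of variables, $T_\Sigma(X)$ the terms over $\Sigma$ and $X$, $T_\Sigma$ the ground terms. A TRS $R$ over $\Sigma$ is a finite set of rules $l\to r$, $l,r\in T_\Sigma(X)$, with every variable of $r$ occurring in $l$; $\Rightarrow_R$ is the rewrite relation on $T_\Sigma(X)$, $\Rightarrow^*_R$ its reflexive transitive closure, and $\Leftrightarrow^*_R$ the reflexive, symmetric, transitive closure of $\Rightarrow_R$; $sign(R)$ is the set of symbols occurring in the rules. $R$ is confluent if $t\Rightarrow^*_R t_1$, $t\Rightarrow^*_R t_2$ imply a common reduct of $t_1,t_2$. For $L\subseteq T_\Sigma$, $R^*_\Sigma(L)=\{p\mid q\Rightarrow^*_R p,\ q\in L\}$. A bottom-up tree automaton (bta) over $\Sigma$ is a finite automaton with states (treated as constants), final states, rules $\delta(a_1,\dots,a_n)\to a$ and $a\to a'$; it recognizes the ground terms rewriting to a final state. $R$ is an EPRF-TRS if for any given ranked alphabet $\Sigma\supseteq sign(R)$ and finite $L\subseteq T_\Sigma$ one can effectively construct a bta $\mathcal{C}$ over $\Sigma$ with $L(\mathcal{C})=R^*_\Sigma(L)$. *)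

theory Defs
  imports Main "HOL-Library.Nat_Bijection" "HOL-Library.Confluence"
begin

section \<open>Terms over a ranked alphabet\<close>

text \<open>A symbol is a pair of a name and its rank, so a ranked alphabet is just a finite set of
  symbols. Names are natural numbers: every finite alphabet embeds, fresh symbols of any rank are
  always available, and terms can be handed to an algorithm.\<close>

type_synonym symbol = "nat \<times> nat"

abbreviation rank :: "symbol \<Rightarrow> nat" where
  "rank \<equiv> snd"

abbreviation ranked_alphabet :: "symbol set \<Rightarrow> bool" where
  "ranked_alphabet \<Sigma> \<equiv> finite \<Sigma>"

datatype trm = Var nat | Fun symbol "trm list"

inductive_set terms :: "symbol set \<Rightarrow> trm set" for \<Sigma> where
  Var: "Var x \<in> terms \<Sigma>"
| Fun: "f \<in> \<Sigma> \<Longrightarrow> length ts = rank f \<Longrightarrow> (\<forall>t \<in> set ts. t \<in> terms \<Sigma>) \<Longrightarrow> Fun f ts \<in> terms \<Sigma>"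

primrec vars :: "trm \<Rightarrow> nat set" where
  "vars (Var x) = {x}"
| "vars (Fun f ts) = \<Union> (set (map vars ts))"

primrec symbols :: "trm \<Rightarrow> symbol set" where
  "symbols (Var x) = {}"
| "symbols (Fun f ts) = insert f (\<Union> (set (map symbols ts)))"

definition ground_terms :: "symbol set \<Rightarrow> trm set" where
  "ground_terms \<Sigma> = {t \<in> terms \<Sigma>. vars t = {}}"

primrec subst :: "(nat \<Rightarrow> trm) \<Rightarrow> trm \<Rightarrow> trm" where
  "subst \<sigma> (Var x) = \<sigma> x"
| "subst \<sigma> (Fun f ts) = Fun f (map (subst \<sigma>) ts)"


section \<open>Term rewrite systems\<close>

type_synonym trs = "(trm \<times> trm) set"

definition trs :: "symbol set \<Rightarrow> trs \<Rightarrow> bool" where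
  "trs \<Sigma> R \<longleftrightarrow> finite R \<and>
     (\<forall>(l, r) \<in> R. l \<in> terms \<Sigma> \<and> r \<in> terms \<Sigma> \<and> vars r \<subseteq> vars l)"

definition sign :: "trs \<Rightarrow> symbol set" where
  "sign R = (\<Union>(l, r) \<in> R. symbols l \<union> symbols r)"

inductive rewr :: "trs \<Rightarrow> trm \<Rightarrow> trm \<Rightarrow> bool" for R where
  root: "(l, r) \<in> R \<Longrightarrow> rewr R (subst \<sigma> l) (subst \<sigma> r)"
| arg: "rewr R s t \<Longrightarrow> rewr R (Fun f (ss @ s # ts)) (Fun f (ss @ t # ts))"

text \<open>The restriction to terms over \<open>\<Sigma>\<close> matters for conversions: an erasing rule applied
  backwards could otherwise introduce symbols outside \<open>\<Sigma>\<close>.\<close>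

definition rstep :: "symbol set \<Rightarrow> trs \<Rightarrow> trm \<Rightarrow> trm \<Rightarrow> bool" where
  "rstep \<Sigma> R s t \<longleftrightarrow> s \<in> terms \<Sigma> \<and> t \<in> terms \<Sigma> \<and> rewr R s t"

definition descendants :: "symbol set \<Rightarrow> trs \<Rightarrow> trm set \<Rightarrow> trm set" where
  "descendants \<Sigma> R L = {p. \<exists>q \<in> L. (rstep \<Sigma> R)\<^sup>*\<^sup>* q p}"


section \<open>Bottom-up tree automata\<close>

record bta =
  states :: "symbol set"
  finals :: "symbol set"
  rules :: trs

abbreviation const :: "symbol \<Rightarrow> trm" where
  "const a \<equiv> Fun a []"

definition is_bta :: "symbol set \<Rightarrow> bta \<Rightarrow> bool" where
  "is_bta \<Sigma> C \<longleftrightarrow>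
     finite (states C) \<and> (\<forall>a \<in> states C. rank a = 0) \<and> states C \<inter> \<Sigma> = {} \<and>
     finals C \<subseteq> states C \<and> finite (rules C) \<and>
     (\<forall>rule \<in> rules C.
        (\<exists>\<delta> as a. \<delta> \<in> \<Sigma> \<and> length as = rank \<delta> \<and> set as \<subseteq> states C \<and> a \<in> states C \<and>
           rule = (Fun \<delta> (map const as), const a)) \<or>
        (\<exists>a a'. a \<in> states C \<and> a' \<in> states C \<and> rule = (const a, const a')))"

definition lang :: "symbol set \<Rightarrow> bta \<Rightarrow> trm set" where
  "lang \<Sigma> C =
     {t \<in> ground_terms \<Sigma>. \<exists>a \<in> finals C. (rstep (\<Sigma> \<union> states C) (rules C))\<^sup>*\<^sup>* t (const a)}"


section \<open>Recursive functions\<close>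

text \<open>\<open>recursive n f\<close>: the \<open>n\<close>-ary function \<open>f\<close>, given on argument lists of length \<open>n\<close>, is total
  recursive, i.e. obtained from the basic functions by composition, primitive recursion and
  minimisation of regular functions (Kleene). Rule \<open>ext\<close> makes the values of \<open>f\<close> on lists of any
  other length irrelevant.\<close>

inductive recursive :: "nat \<Rightarrow> (nat list \<Rightarrow> nat) \<Rightarrow> bool" where
  zero: "recursive n (\<lambda>xs. 0)"
| succ: "recursive 1 (\<lambda>xs. Suc (xs ! 0))"
| proj: "i < n \<Longrightarrow> recursive n (\<lambda>xs. xs ! i)"
| comp: "recursive (length gs) f \<Longrightarrow> (\<forall>g \<in> set gs. recursive n g) \<Longrightarrow>
    recursive n (\<lambda>xs. f (map (\<lambda>g. g xs) gs))"
| prec: "recursive n f \<Longrightarrow> recursive (Suc (Suc n)) g \<Longrightarrow>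
    recursive (Suc n) (\<lambda>xs. rec_nat (f (tl xs)) (\<lambda>k y. g (k # y # tl xs)) (hd xs))"
| mini: "recursive (Suc n) f \<Longrightarrow> (\<forall>xs. length xs = n \<longrightarrow> (\<exists>y. f (y # xs) = 0)) \<Longrightarrow>
    recursive n (\<lambda>xs. LEAST y. f (y # xs) = 0)"
| ext: "recursive n f \<Longrightarrow> (\<forall>xs. length xs = n \<longrightarrow> f xs = g xs) \<Longrightarrow> recursive n g"


section \<open>Codes of finite objects\<close>

abbreviation code_symbol :: "symbol \<Rightarrow> nat" where
  "code_symbol \<equiv> prod_encode"

primrec code_trm :: "trm \<Rightarrow> nat" where
  "code_trm (Var x) = sum_encode (Inl x)"
| "code_trm (Fun f ts) =
     sum_encode (Inr (prod_encode (code_symbol f, list_encode (map code_trm ts))))"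

lemma inj_code_trm: "inj code_trm"
proof -
  have "code_trm s = code_trm t \<Longrightarrow> s = t" for s t
  proof (induction s arbitrary: t)
    case (Var x)
    then show ?case by (cases t) (auto simp: sum_encode_eq)
  next
    case (Fun f ss)
    then obtain ts where t: "t = Fun f ts" and eq: "map code_trm ss = map code_trm ts"
      by (cases t) (auto simp: sum_encode_eq list_encode_eq)
    have "ss = ts"
      by (rule list.inj_map_strong[OF _ eq]) (rule Fun.IH)
    with t show ?case by simp
  qed
  then show ?thesis by (rule injI)
qed

definition code_rule :: "trm \<times> trm \<Rightarrow> nat" where
  "code_rule lr = prod_encode (code_trm (fst lr), code_trm (snd lr))"

text \<open>A finite set is presented by a list of its elements, in any order and possibly with
  repetitions.\<close>

definition codes_set :: "('a \<Rightarrow> nat) \<Rightarrow> nat \<Rightarrow> 'a set \<Rightarrow> bool" where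
  "codes_set c m A \<longleftrightarrow> (\<exists>xs. set xs = A \<and> m = list_encode (map c xs))"

definition codes_bta :: "nat \<Rightarrow> bta \<Rightarrow> bool" where
  "codes_bta m C \<longleftrightarrow> (\<exists>i j k. m = prod_encode (i, prod_encode (j, k)) \<and>
     codes_set code_symbol i (states C) \<and>
     codes_set code_symbol j (finals C) \<and>
     codes_set code_rule k (rules C))"


section \<open>Effective preservation of recognizability of finite tree languages\<close>

definition EPRF :: "trs \<Rightarrow> bool" where
  "EPRF R \<longleftrightarrow> (\<exists>F. recursive 2 F \<and>
     (\<forall>\<Sigma> L m k. ranked_alphabet \<Sigma> \<longrightarrow> sign R \<subseteq> \<Sigma> \<longrightarrow> finite L \<longrightarrow> L \<subseteq> ground_terms \<Sigma> \<longrightarrow>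
        codes_set code_symbol m \<Sigma> \<longrightarrow> codes_set code_trm k L \<longrightarrow>
        (\<exists>C. is_bta \<Sigma> C \<and> codes_bta (F [m, k]) C \<and> lang \<Sigma> C = descendants \<Sigma> R L)))"

text \<open>Decidability of a binary relation between terms, for inputs taken from \<open>T\<close>.\<close>

definition decidable_on :: "trm set \<Rightarrow> (trm \<Rightarrow> trm \<Rightarrow> bool) \<Rightarrow> bool" where
  "decidable_on T P \<longleftrightarrow> (\<exists>f. recursive 2 f \<and>
     (\<forall>p \<in> T. \<forall>q \<in> T. f [code_trm p, code_trm q] = (if P p q then 1 else 0)))"

end

(* Replacing variables by fresh constants turns p and q into ground terms, and by confluence
   p and q are convertible iff the sets of their descendants meet. Both sets are recognized by
   automata computed from p and q. The languages of two automata meet iff every set of pairs of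
   right-hand sides that is closed under the product rules contains a pair of final states; there
   are finitely many such sets, and they are enumerated as the bit patterns below a computable
   bound. *)

theory Submission
  imports Defs
begin

text \<open>\<open>EPRF\<close> speaks about finite sets of ground terms only, but uniformly over
  every alphabet containing the symbols of \<open>R\<close>; this uniformity admits constants that
  depend on the input. \<open>\<Sigma>\<close>, a bound \<open>N\<close> on its names and the
  function \<open>F\<close> are fixed, so only the number of added constants varies with the two
  terms. Confluence is applied over \<open>\<Sigma>\<close>, and \<open>unfreeze\<close> carries
  common descendants over the larger alphabet back to it. Since \<open>recursive\<close> is a bare
  inductive predicate, the whole decision procedure has to be assembled from composition, recursion
  and minimisation, which dictates its brute-force form. The pairs of right-hand sides reached by a
  common ground term form the least closed set; quantifying over all closed sets instead replaces a
  saturation process by one bounded quantifier over numbers, with no product automaton to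
  encode.\<close>

section \<open>Closure properties of total recursive functions\<close>

text \<open>Reading a missing argument as 0 makes every closure property independent of the arity,
  so that \<open>tl xs\<close> serves as the context below a binder.\<close>

definition arg :: "nat \<Rightarrow> nat list \<Rightarrow> nat" where
  "arg i xs = (if i < length xs then xs ! i else 0)"

lemma arg_0_Cons [simp]: "arg 0 (x # xs) = x"
  and arg_Suc_Cons [simp]: "arg (Suc i) (x # xs) = arg i xs"
  and arg_tl [simp]: "arg i (tl xs) = arg (Suc i) xs"
  by (auto simp: arg_def nth_tl)

lemma arg_numeral_Cons [simp]: "arg (numeral k) (x # xs) = arg (pred_numeral k) xs"
  by (simp add: numeral_eq_Suc)

lemma map_arg: "length xs = n \<Longrightarrow> map (\<lambda>i. arg i xs) [0..<n] = xs"
  by (rule nth_equalityI) (auto simp: arg_def)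

definition computable :: "(nat list \<Rightarrow> nat) \<Rightarrow> bool" where
  "computable f \<longleftrightarrow> (\<forall>n. recursive n f)"

definition decidable :: "(nat list \<Rightarrow> bool) \<Rightarrow> bool" where
  "decidable P \<longleftrightarrow> computable (\<lambda>xs. of_bool (P xs))"

named_theorems computable_intros

section \<open>Basic functions and changes of the argument list\<close>

lemma computable_arg [computable_intros]: "computable (arg i)"
  unfolding computable_def
proof
  fix n
  show "recursive n (arg i)"
  proof (cases "i < n")
    case True
    then show ?thesis
      by (intro recursive.ext[OF recursive.proj[of i n]]) (auto simp: arg_def)
  next
    case False
    then show ?thesis
      by (intro recursive.ext[OF recursive.zero[of n]]) (auto simp: arg_def)
  qed
qed

lemma computable_comp:
  assumes "recursive (length gs) h" "\<forall>g \<in> set gs. computable g"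
  shows "computable (\<lambda>xs. h (map (\<lambda>g. g xs) gs))"
  using assms recursive.comp[of gs h] by (simp add: computable_def)

lemma computable_comp1:
  assumes "recursive 1 (\<lambda>xs. h (arg 0 xs))" "computable f"
  shows "computable (\<lambda>xs. h (f xs))"
  using computable_comp[of "[f]" "\<lambda>xs. h (arg 0 xs)"] assms by simp

lemma computable_comp2:
  assumes "recursive 2 (\<lambda>xs. h (arg 0 xs) (arg 1 xs))" "computable f" "computable g"
  shows "computable (\<lambda>xs. h (f xs) (g xs))"
  using computable_comp[of "[f, g]" "\<lambda>xs. h (arg 0 xs) (arg 1 xs)"] assms by (simp add: numeral_2_eq_2)

lemma computable_Suc [computable_intros]:
  assumes "computable f"
  shows "computable (\<lambda>xs. Suc (f xs))"
  by (rule computable_comp1[OF recursive.ext[OF recursive.succ] assms]) (auto simp: arg_def)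

lemma computable_const [computable_intros]: "computable (\<lambda>xs. c)"
proof (induction c)
  case 0
  then show ?case by (simp add: computable_def recursive.zero)
qed (rule computable_Suc)

text \<open>Composition takes a fixed list of inner functions, whereas the length of
  \<open>e xs\<close> may vary with that of \<open>xs\<close>; hence \<open>gs\<close> is chosen
  separately for each arity.\<close>

lemma computable_map_env:
  assumes "computable f"
    and "\<And>n. \<exists>gs. (\<forall>g \<in> set gs. computable g) \<and> (\<forall>xs. length xs = n \<longrightarrow> map (\<lambda>g. g xs) gs = e xs)"
  shows "computable (\<lambda>xs. f (e xs))"
  unfolding computable_def
proof
  fix n
  obtain gs where gs: "\<forall>g \<in> set gs. computable g" and e: "\<And>xs. length xs = n \<Longrightarrow> map (\<lambda>g. g xs) gs = e xs"
    using assms(2) by blast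
  have "recursive n (\<lambda>xs. f (map (\<lambda>g. g xs) gs))"
    using assms(1) gs by (intro recursive.comp) (auto simp: computable_def)
  then show "recursive n (\<lambda>xs. f (e xs))"
    by (rule recursive.ext) (simp add: e)
qed

lemma computable_tl:
  assumes "computable f"
  shows "computable (\<lambda>xs. f (tl xs))"
proof (rule computable_map_env[OF assms], intro exI conjI allI impI)
  fix n and xs :: "nat list" assume "length xs = n"
  then show "map (\<lambda>g. g xs) (map (\<lambda>i. arg (Suc i)) [0..<n - 1]) = tl xs"
    using map_arg[of "tl xs" "n - 1"] by (simp add: comp_def)
qed (auto intro: computable_arg)

lemma computable_Cons:
  assumes "computable f" "computable g"
  shows "computable (\<lambda>xs. f (g xs # xs))"
proof (rule computable_map_env[OF assms(1)], intro exI conjI allI impI)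
  fix n and xs :: "nat list" assume "length xs = n"
  then show "map (\<lambda>g. g xs) (g # map arg [0..<n]) = g xs # xs"
    by (simp add: comp_def map_arg)
qed (use assms computable_arg in auto)

text \<open>Under nested binders an outer variable appears as \<open>arg i\<close> of an iterated
  tail. The conclusion of \<open>computable_tl\<close> is too unspecific for automatic use, so only
  these instances are collected.\<close>

lemmas computable_arg_tl [computable_intros] =
  computable_arg[THEN computable_tl]
  computable_arg[THEN computable_tl, THEN computable_tl]
  computable_arg[THEN computable_tl, THEN computable_tl, THEN computable_tl]
  computable_arg[THEN computable_tl, THEN computable_tl, THEN computable_tl, THEN computable_tl]

text \<open>In a recursion step the accumulator sits between the counter and the context; a
  predicate of the counter alone needs it cut out.\<close>

lemma computable_drop_second:
  assumes "computable f"
  shows "computable (\<lambda>xs. f (arg 0 xs # tl (tl xs)))"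
proof (rule computable_map_env[OF assms], intro exI conjI allI impI)
  fix n and xs :: "nat list" assume "length xs = n"
  then show "map (\<lambda>g. g xs) (arg 0 # map (\<lambda>i. arg (Suc (Suc i))) [0..<n - 2]) = arg 0 xs # tl (tl xs)"
    using map_arg[of "tl (tl xs)" "n - 2"] by (simp add: comp_def)
qed (use computable_arg in auto)

section \<open>Recursion, minimisation and case distinction\<close>

lemma computable_rec_nat [computable_intros]:
  assumes "computable f" "computable (\<lambda>ys. g (arg 0 ys) (arg 1 ys) (tl (tl ys)))" "computable k"
  shows "computable (\<lambda>xs. rec_nat (f xs) (\<lambda>i y. g i y xs) (k xs))"
proof -
  let ?G = "\<lambda>ys. g (arg 0 ys) (arg 1 ys) (tl (tl ys))"
  \<comment> \<open>\<open>prec\<close> recurses on the first argument, so the bound is made that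
    argument here; prepending \<open>k xs\<close> later yields an arbitrary bound.\<close>
  let ?h = "\<lambda>ys. rec_nat (f (tl ys)) (\<lambda>i y. g i y (tl ys)) (arg 0 ys)"
  have "computable ?h"
    unfolding computable_def
  proof
    fix n
    show "recursive n ?h"
    proof (cases n)
      \<comment> \<open>Without arguments the bound \<open>arg 0\<close> reads 0, and only the base
        value is left.\<close>
      case 0
      have "recursive 0 f" using assms by (simp add: computable_def)
      then show ?thesis unfolding 0 by (rule recursive.ext) (auto simp: arg_def)
    next
      case (Suc m)
      have "recursive (Suc m) (\<lambda>ys. rec_nat (f (tl ys)) (\<lambda>k y. ?G (k # y # tl ys)) (hd ys))"
        using assms by (intro recursive.prec) (auto simp: computable_def)
      then show ?thesis unfolding Suc
        by (rule recursive.ext) (auto simp: length_Suc_conv)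
    qed
  qed
  from computable_Cons[OF this assms(3)] show ?thesis by simp
qed

lemma computable_Least:
  assumes "computable (\<lambda>ys. f (arg 0 ys) (tl ys))" "\<And>xs. \<exists>y. f y xs = 0"
  shows "computable (\<lambda>xs. LEAST y. f y xs = 0)"
  unfolding computable_def
proof
  fix n
  show "recursive n (\<lambda>xs. LEAST y. f y xs = 0)"
    using recursive.mini[of n "\<lambda>ys. f (arg 0 ys) (tl ys)"] assms
    by (simp add: computable_def)
qed

text \<open>A case distinction is a recursion of length 0 or 1. The step function sees counter and
  accumulator in front of \<open>xs\<close>, hence the two tails on \<open>f\<close>.\<close>

lemma computable_if [computable_intros]:
  assumes "decidable P" "computable f" "computable g"
  shows "computable (\<lambda>xs. if P xs then f xs else g xs)"
proof -
  have "computable (\<lambda>xs. rec_nat (g xs) (\<lambda>_ _. f xs) (of_bool (P xs)))"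
    using assms computable_tl[OF computable_tl[OF assms(2)]] unfolding decidable_def
    by (intro computable_rec_nat)
  also have "(\<lambda>xs. rec_nat (g xs) (\<lambda>_ _. f xs) (of_bool (P xs))) = (\<lambda>xs. if P xs then f xs else g xs)"
    by auto
  finally show ?thesis .
qed

section \<open>Arithmetic and decidable predicates\<close>

lemma computable_add [computable_intros]:
  assumes "computable f" "computable g"
  shows "computable (\<lambda>xs. f xs + g xs)"
proof -
  have "computable (\<lambda>xs. rec_nat (f xs) (\<lambda>i y. Suc y) (g xs))"
    using assms by (intro computable_intros)
  moreover have "rec_nat a (\<lambda>i y. Suc y) b = a + b" for a b
    by (induction b) auto
  ultimately show ?thesis by simp
qed

lemma computable_mult [computable_intros]:
  assumes "computable f" "computable g"
  shows "computable (\<lambda>xs. f xs * g xs)"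
proof -
  have "computable (\<lambda>xs. rec_nat 0 (\<lambda>i y. y + f xs) (g xs))"
    using assms computable_tl[OF computable_tl[OF assms(1)]] by (intro computable_intros)
  moreover have "rec_nat 0 (\<lambda>i y. y + a) b = a * b" for a b :: nat
    by (induction b) auto
  ultimately show ?thesis by simp
qed

lemma computable_power [computable_intros]:
  assumes "computable f" "computable g"
  shows "computable (\<lambda>xs. f xs ^ g xs)"
proof -
  have "computable (\<lambda>xs. rec_nat 1 (\<lambda>i y. f xs * y) (g xs))"
    using assms computable_tl[OF computable_tl[OF assms(1)]] by (intro computable_intros)
  moreover have "rec_nat 1 (\<lambda>i y. a * y) b = a ^ b" for a b :: nat
    by (induction b) auto
  ultimately show ?thesis by simp
qed

lemma computable_diff [computable_intros]:
  assumes "computable f" "computable g"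
  shows "computable (\<lambda>xs. f xs - g xs)"
proof -
  have pred: "computable (\<lambda>xs. h xs - 1)" if "computable h" for h
  proof -
    have "computable (\<lambda>xs. rec_nat 0 (\<lambda>i y. i) (h xs))"
      using that by (intro computable_intros)
    moreover have "rec_nat 0 (\<lambda>i y. i) b = b - 1" for b
      by (cases b) auto
    ultimately show ?thesis by simp
  qed
  have "computable (\<lambda>xs. rec_nat (f xs) (\<lambda>i y. y - 1) (g xs))"
    using assms by (intro computable_intros pred)
  moreover have "rec_nat a (\<lambda>i y. y - 1) b = a - b" for a b :: nat
    by (induction b) auto
  ultimately show ?thesis by simp
qed

lemma decidable_eq_0:
  assumes "computable f"
  shows "decidable (\<lambda>xs. f xs = 0)"
proof -
  have "computable (\<lambda>xs. 1 - f xs)"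
    using assms by (intro computable_intros)
  moreover have "1 - a = of_bool (a = 0)" for a :: nat by simp
  ultimately show ?thesis by (simp add: decidable_def)
qed

lemma decidable_not [computable_intros]: "decidable P \<Longrightarrow> decidable (\<lambda>xs. \<not> P xs)"
  unfolding decidable_def[of P] by (drule decidable_eq_0) simp

lemma decidable_le [computable_intros]:
  assumes "computable f" "computable g"
  shows "decidable (\<lambda>xs. f xs \<le> g xs)"
  using decidable_eq_0[OF computable_diff[OF assms]] by simp

lemma decidable_and [computable_intros]:
  assumes "decidable P" "decidable Q"
  shows "decidable (\<lambda>xs. P xs \<and> Q xs)"
  using assms unfolding decidable_def of_bool_conj by (rule computable_mult)

lemma decidable_or [computable_intros]:
  assumes "decidable P" "decidable Q"
  shows "decidable (\<lambda>xs. P xs \<or> Q xs)"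
proof -
  have "decidable (\<lambda>xs. \<not> (\<not> P xs \<and> \<not> Q xs))"
    using assms by (intro computable_intros)
  then show ?thesis by simp
qed

lemma decidable_imp [computable_intros]:
  assumes "decidable P" "decidable Q"
  shows "decidable (\<lambda>xs. P xs \<longrightarrow> Q xs)"
  unfolding imp_conv_disj using assms by (intro computable_intros)

lemma decidable_eq [computable_intros]:
  assumes "computable f" "computable g"
  shows "decidable (\<lambda>xs. f xs = g xs)"
  unfolding eq_iff using assms by (intro computable_intros)

text \<open>The recursion accumulates the product of the truth values.\<close>

lemma decidable_All_less [computable_intros]:
  assumes "computable b" "decidable (\<lambda>ys. P (arg 0 ys) (tl ys))"
  shows "decidable (\<lambda>xs. \<forall>y<b xs. P y xs)"
proof -
  let ?p = "\<lambda>ys. of_bool (P (arg 0 ys) (tl ys))"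
  have "computable (\<lambda>xs. rec_nat 1 (\<lambda>i y. y * of_bool (P i xs)) (b xs))"
  proof (intro computable_intros assms(1))
    show "computable (\<lambda>ys. of_bool (P (arg 0 ys) (tl (tl ys))))"
      using computable_drop_second[of ?p] assms(2) by (simp add: decidable_def)
  qed
  moreover have "rec_nat (1 :: nat) (\<lambda>i y. y * of_bool (P i xs)) c = of_bool (\<forall>y<c. P y xs)" for c xs
    by (induction c) (auto simp: less_Suc_eq)
  ultimately show ?thesis by (simp add: decidable_def)
qed

lemma decidable_Ex_less [computable_intros]:
  assumes "computable b" "decidable (\<lambda>ys. P (arg 0 ys) (tl ys))"
  shows "decidable (\<lambda>xs. \<exists>y<b xs. P y xs)"
proof -
  have "decidable (\<lambda>xs. \<not> (\<forall>y<b xs. \<not> P y xs))"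
    using assms by (intro computable_intros)
  then show ?thesis by simp
qed

text \<open>Unbounded search for the only value that satisfies the graph; it terminates because
  \<open>f xs\<close> is always a witness. Inverse operations such as halving and unpairing are
  obtained this way.\<close>

lemma computable_graph:
  assumes "decidable (\<lambda>ys. P (arg 0 ys) (tl ys))" "\<And>y xs. P y xs \<longleftrightarrow> y = f xs"
  shows "computable f"
proof -
  have "computable (\<lambda>xs. LEAST y. of_bool (\<not> P y xs) = (0 :: nat))"
    using decidable_not[OF assms(1)] by (intro computable_Least) (auto simp: decidable_def assms(2))
  moreover have "(LEAST y. of_bool (\<not> P y xs) = (0 :: nat)) = f xs" for xs
    by (rule Least_equality) (auto simp: assms(2))
  ultimately show ?thesis by simp
qed

section \<open>Recursive functions on codes\<close>

text \<open>Separates an operation from the functions feeding it: the operation is then treated on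
  bare arguments, and no assumption on \<open>f\<close> has to be carried under binders.\<close>

lemma computable_subst1:
  assumes "computable (\<lambda>xs. h (arg 0 xs))" "computable f"
  shows "computable (\<lambda>xs. h (f xs))"
  using assms computable_comp1[of h f] unfolding computable_def by blast

lemma computable_subst2:
  assumes "computable (\<lambda>xs. h (arg 0 xs) (arg 1 xs))" "computable f" "computable g"
  shows "computable (\<lambda>xs. h (f xs) (g xs))"
  using assms computable_comp2[of h f g] unfolding computable_def by blast

lemma decidable_subst2:
  assumes "decidable (\<lambda>xs. P (arg 0 xs) (arg 1 xs))" "computable f" "computable g"
  shows "decidable (\<lambda>xs. P (f xs) (g xs))"
  using assms computable_subst2[of "\<lambda>a b. of_bool (P a b)" f g] unfolding decidable_def by blast

lemma decidable_subst3:
  assumes "decidable (\<lambda>xs. P (arg 0 xs) (arg 1 xs) (arg 2 xs))" "computable f" "computable g" "computable h"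
  shows "decidable (\<lambda>xs. P (f xs) (g xs) (h xs))"
proof -
  have "recursive 3 (\<lambda>xs. of_bool (P (arg 0 xs) (arg 1 xs) (arg 2 xs)))"
    using assms(1) unfolding decidable_def computable_def by blast
  then show ?thesis
    using computable_comp[of "[f, g, h]" "\<lambda>xs. of_bool (P (arg 0 xs) (arg 1 xs) (arg 2 xs))"] assms(2-)
    unfolding decidable_def by (simp add: numeral_3_eq_3)
qed

section \<open>Binary digits and pairs\<close>

lemma computable_div_2 [computable_intros]:
  assumes "computable f"
  shows "computable (\<lambda>xs. f xs div 2)"
proof (rule computable_subst1[OF _ assms, of "\<lambda>a. a div 2"], rule computable_graph)
  show "arg 0 xs = 2 * y \<or> arg 0 xs = Suc (2 * y) \<longleftrightarrow> y = arg 0 xs div 2" for xs y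
    by presburger
  show "decidable (\<lambda>ys. arg 0 (tl ys) = 2 * arg 0 ys \<or> arg 0 (tl ys) = Suc (2 * arg 0 ys))"
    by (intro computable_intros)
qed

lemma decidable_odd [computable_intros]:
  assumes "computable f"
  shows "decidable (\<lambda>xs. odd (f xs))"
proof -
  have "decidable (\<lambda>xs. f xs \<noteq> 2 * (f xs div 2))"
    using assms by (intro computable_intros)
  moreover have "a \<noteq> 2 * (a div 2) \<longleftrightarrow> odd a" for a :: nat by presburger
  ultimately show ?thesis by simp
qed

text \<open>\<open>set_decode\<close> reads a number as the set of positions of its binary ones, so
  membership is oddness after repeated halving.\<close>

lemma decidable_set_decode [computable_intros]:
  assumes "computable f" "computable g"
  shows "decidable (\<lambda>xs. f xs \<in> set_decode (g xs))"
proof -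
  have "computable (\<lambda>xs. rec_nat (g xs) (\<lambda>_ y. y div 2) (f xs))"
    using assms by (intro computable_intros)
  moreover have "rec_nat a (\<lambda>_ y. y div 2) k = a div 2 ^ k" for a k :: nat
    by (induction k) (auto simp flip: div_mult2_eq simp: mult.commute)
  ultimately show ?thesis
    by (simp add: set_decode_def decidable_odd)
qed

lemma computable_prod_encode [computable_intros]:
  assumes "computable f" "computable g"
  shows "computable (\<lambda>xs. prod_encode (f xs, g xs))"
proof -
  have "computable (\<lambda>xs. (f xs + g xs) * Suc (f xs + g xs) div 2 + f xs)"
    using assms by (intro computable_intros)
  then show ?thesis by (simp add: prod_encode_def triangle_def)
qed

text \<open>Each component is at most the code of the pair, so the other component can be searched
  for below a bound and the graph is decidable.\<close>

lemma computable_prod_decode [computable_intros]: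
  assumes "computable f"
  shows "computable (\<lambda>xs. fst (prod_decode (f xs)))" "computable (\<lambda>xs. snd (prod_decode (f xs)))"
proof -
  have eq: "prod_encode (a, b) = c \<longleftrightarrow> prod_decode c = (a, b)" for a b c
    by (metis prod_decode_inverse prod_encode_inverse)
  have bound: "a < Suc c \<and> b < Suc c" if "prod_decode c = (a, b)" for a b c
    using that le_prod_encode_1[of a b] le_prod_encode_2[of b a] by (auto simp: less_Suc_eq_le simp flip: eq)
  show "computable (\<lambda>xs. fst (prod_decode (f xs)))"
  proof (rule computable_subst1[OF _ assms, of "\<lambda>a. fst (prod_decode a)"], rule computable_graph)
    show "(\<exists>b<Suc (arg 0 xs). prod_encode (a, b) = arg 0 xs) \<longleftrightarrow> a = fst (prod_decode (arg 0 xs))" for xs a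
      using bound[of "arg 0 xs"] by (cases "prod_decode (arg 0 xs)") (auto simp: eq)
    show "decidable (\<lambda>ys. \<exists>b<Suc (arg 0 (tl ys)). prod_encode (arg 0 ys, b) = arg 0 (tl ys))"
      by (intro computable_intros)
  qed
  show "computable (\<lambda>xs. snd (prod_decode (f xs)))"
  proof (rule computable_subst1[OF _ assms, of "\<lambda>a. snd (prod_decode a)"], rule computable_graph)
    show "(\<exists>a<Suc (arg 0 xs). prod_encode (a, b) = arg 0 xs) \<longleftrightarrow> b = snd (prod_decode (arg 0 xs))" for xs b
      using bound[of "arg 0 xs"] by (cases "prod_decode (arg 0 xs)") (auto simp: eq)
    show "decidable (\<lambda>ys. \<exists>a<Suc (arg 0 (tl ys)). prod_encode (a, arg 0 ys) = arg 0 (tl ys))"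
      by (intro computable_intros)
  qed
qed

section \<open>Coded lists\<close>

lemma computable_drop [computable_intros]:
  assumes "computable f" "computable g"
  shows "computable (\<lambda>xs. list_encode (drop (f xs) (list_decode (g xs))))"
proof -
  have "computable (\<lambda>xs. rec_nat (g xs) (\<lambda>_ y. snd (prod_decode (y - 1))) (f xs))"
    using assms by (intro computable_intros)
  \<comment> \<open>For the empty list truncated subtraction leaves 0, which decodes to
    \<open>(0, 0)\<close>, so the empty list is its own tail.\<close>
  moreover have "snd (prod_decode (list_encode xs - 1)) = list_encode (tl xs)" for xs
    using prod_encode_inverse[of "(0, 0)", unfolded prod_encode_def] by (cases xs) simp_all
  then have "rec_nat l (\<lambda>_ y. snd (prod_decode (y - 1))) k = list_encode (drop k (list_decode l))" for l k
    by (induction k) (simp_all add: drop_Suc tl_drop)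
  ultimately show ?thesis by simp
qed

definition code_nth :: "nat \<Rightarrow> nat \<Rightarrow> nat" where
  "code_nth l i = fst (prod_decode (list_encode (drop i (list_decode l)) - 1))"

lemma code_nth_eq: "i < length (list_decode l) \<Longrightarrow> code_nth l i = list_decode l ! i"
  by (simp add: code_nth_def flip: Cons_nth_drop_Suc)

lemma computable_code_nth [computable_intros]:
  assumes "computable f" "computable g"
  shows "computable (\<lambda>xs. code_nth (f xs) (g xs))"
  unfolding code_nth_def using assms by (intro computable_intros)

lemma list_encode_eq_0_iff: "list_encode xs = 0 \<longleftrightarrow> xs = []"
  by (cases xs) auto

text \<open>Only the empty list has code 0, so the length is the first \<open>n\<close> for which
  dropping \<open>n\<close> elements gives 0.\<close>

lemma computable_length [computable_intros]:
  assumes "computable f"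
  shows "computable (\<lambda>xs. length (list_decode (f xs)))"
proof (rule computable_subst1[OF _ assms, of "\<lambda>a. length (list_decode a)"], rule computable_graph)
  let ?d = "\<lambda>i l. list_encode (drop i (list_decode l))"
  show "?d n (arg 0 xs) = 0 \<and> (\<forall>i<n. ?d i (arg 0 xs) \<noteq> 0) \<longleftrightarrow> n = length (list_decode (arg 0 xs))" for n xs
    by (auto simp: list_encode_eq_0_iff not_le) (metis le_less_linear le_neq_implies_less less_irrefl)
  show "decidable (\<lambda>ys. ?d (arg 0 ys) (arg 0 (tl ys)) = 0 \<and> (\<forall>i<arg 0 ys. ?d i (arg 0 (tl ys)) \<noteq> 0))"
    by (intro computable_intros)
qed

lemma decidable_list_all2 [computable_intros]:
  assumes "computable f" "computable g" "computable h"
  shows "decidable (\<lambda>xs. list_all2 (\<lambda>a b. prod_encode (a, b) \<in> set_decode (h xs))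
    (list_decode (f xs)) (list_decode (g xs)))"
proof (rule decidable_subst3[OF _ assms,
    of "\<lambda>l k s. list_all2 (\<lambda>a b. prod_encode (a, b) \<in> set_decode s) (list_decode l) (list_decode k)"])
  have "list_all2 (\<lambda>a b. prod_encode (a, b) \<in> set_decode s) (list_decode l) (list_decode k) \<longleftrightarrow>
      length (list_decode l) = length (list_decode k) \<and>
      (\<forall>i<length (list_decode l). prod_encode (code_nth l i, code_nth k i) \<in> set_decode s)" for l k s
    by (auto simp: list_all2_conv_all_nth code_nth_eq)
  moreover have "decidable (\<lambda>xs. length (list_decode (arg 0 xs)) = length (list_decode (arg 1 xs)) \<and>
      (\<forall>i<length (list_decode (arg 0 xs)).
         prod_encode (code_nth (arg 0 xs) i, code_nth (arg 1 xs) i) \<in> set_decode (arg 2 xs)))"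
    by (intro computable_intros)
  ultimately show "decidable (\<lambda>xs. list_all2 (\<lambda>a b. prod_encode (a, b) \<in> set_decode (arg 2 xs))
    (list_decode (arg 0 xs)) (list_decode (arg 1 xs)))"
    by presburger
qed

text \<open>Pairing dominates both components and each cons adds a successor. Quantifiers over list
  members thereby become bounded quantifiers.\<close>

lemma less_list_encode: "x \<in> set xs \<Longrightarrow> x < list_encode xs"
proof (induction xs)
  case (Cons y xs)
  then show ?case
    using le_prod_encode_1[of y "list_encode xs"] le_prod_encode_2[of "list_encode xs" y] by auto
qed auto

lemma decidable_member [computable_intros]:
  assumes "computable f" "computable g"
  shows "decidable (\<lambda>xs. f xs \<in> set (list_decode (g xs)))"
proof (rule decidable_subst2[OF _ assms, of "\<lambda>a l. a \<in> set (list_decode l)"])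
  have "a \<in> set (list_decode l) \<longleftrightarrow> (\<exists>i<length (list_decode l). code_nth l i = a)" for a l
    by (auto simp: in_set_conv_nth code_nth_eq)
  moreover have "decidable (\<lambda>xs. \<exists>i<length (list_decode (arg 1 xs)). code_nth (arg 1 xs) i = arg 0 xs)"
    by (intro computable_intros)
  ultimately show "decidable (\<lambda>xs. arg 0 xs \<in> set (list_decode (arg 1 xs)))"
    by presburger
qed

lemma decidable_Ball_list_decode [computable_intros]:
  assumes "computable f" "decidable (\<lambda>ys. P (arg 0 ys) (tl ys))"
  shows "decidable (\<lambda>xs. \<forall>a\<in>set (list_decode (f xs)). P a xs)"
proof -
  have "decidable (\<lambda>xs. \<forall>a<f xs. a \<in> set (list_decode (f xs)) \<longrightarrow> P a xs)"
    using assms computable_tl[OF assms(1)] by (intro computable_intros)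
  moreover have "(\<forall>a<l. a \<in> set (list_decode l) \<longrightarrow> Q a) \<longleftrightarrow> (\<forall>a\<in>set (list_decode l). Q a)" for l Q
    using less_list_encode[of _ "list_decode l"] by auto
  ultimately show ?thesis by simp
qed

lemma decidable_Bex_list_decode [computable_intros]:
  assumes "computable f" "decidable (\<lambda>ys. P (arg 0 ys) (tl ys))"
  shows "decidable (\<lambda>xs. \<exists>a\<in>set (list_decode (f xs)). P a xs)"
proof -
  have "decidable (\<lambda>xs. \<not> (\<forall>a\<in>set (list_decode (f xs)). \<not> P a xs))"
    using assms by (intro computable_intros)
  then show ?thesis by simp
qed

text \<open>Course-of-values recursion: \<open>history G n\<close> codes the list of the values at
  \<open>n - 1, \<dots>, 0\<close>, the latest first.\<close>

definition history :: "(nat \<Rightarrow> nat \<Rightarrow> nat) \<Rightarrow> nat \<Rightarrow> nat" where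
  "history G = rec_nat 0 (\<lambda>i h. Suc (prod_encode (G i h, h)))"

lemma code_nth_history:
  assumes "i < n"
  shows "code_nth (history G n) (n - Suc i) = G i (history G i)"
proof -
  have "list_decode (history G n) = map (\<lambda>i. G i (history G i)) (rev [0..<n])"
    by (induction n) (simp_all add: history_def)
  with assms show ?thesis
    by (simp add: code_nth_eq rev_nth)
qed

lemma computable_history:
  assumes "computable (\<lambda>xs. G (arg 0 xs) (arg 1 xs))" "computable f"
  shows "computable (\<lambda>xs. history G (f xs))"
  unfolding history_def using assms by (intro computable_intros)

section \<open>Terms and rewriting\<close>

lemma vars_subst: "vars (subst \<sigma> t) = (\<Union>x \<in> vars t. vars (\<sigma> x))"
  by (induction t) auto

lemma subst_subst: "subst \<sigma> (subst \<tau> t) = subst (\<lambda>x. subst \<sigma> (\<tau> x)) t"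
  by (induction t) auto

lemma terms_Fun_iff: "Fun f ts \<in> terms \<Sigma> \<longleftrightarrow> f \<in> \<Sigma> \<and> length ts = rank f \<and> set ts \<subseteq> terms \<Sigma>"
  by (auto intro: terms.Fun elim: terms.cases)

lemma terms_mono: "t \<in> terms \<Sigma> \<Longrightarrow> \<Sigma> \<subseteq> \<Delta> \<Longrightarrow> t \<in> terms \<Delta>"
  by (induction t) (auto simp: terms_Fun_iff terms.Var)

lemma subst_in_terms:
  assumes "t \<in> terms \<Sigma>" "\<And>x. x \<in> vars t \<Longrightarrow> \<sigma> x \<in> terms \<Sigma>"
  shows "subst \<sigma> t \<in> terms \<Sigma>"
  using assms by (induction t) (auto simp: terms_Fun_iff)

lemma rewr_subst:
  assumes "rewr R s t"
  shows "rewr R (subst \<sigma> s) (subst \<sigma> t)"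
  using assms by induction (auto simp: subst_subst intro: rewr.intros)

lemma rewr_vars:
  assumes "rewr R s t" "trs \<Sigma> R"
  shows "vars t \<subseteq> vars s"
  using assms(1)
proof induction
  case (root l r \<sigma>)
  then show ?case using assms(2) by (fastforce simp: trs_def vars_subst)
qed auto

section \<open>Variables as fresh constants\<close>

text \<open>With \<open>N\<close> above all names in \<open>\<Sigma>\<close>, these constants lie
  outside \<open>\<Sigma>\<close>, and subtraction recovers the variable.\<close>

definition fresh :: "nat \<Rightarrow> nat \<Rightarrow> symbol" where
  "fresh N x = (N + x, 0)"

definition freeze :: "nat \<Rightarrow> trm \<Rightarrow> trm" where
  "freeze N = subst (\<lambda>x. const (fresh N x))"

text \<open>Testing only the name makes the function total on all terms, at the price of discarding
  whatever stands below a fresh name.\<close>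

primrec unfreeze :: "nat \<Rightarrow> trm \<Rightarrow> trm" where
  "unfreeze N (Var x) = Var x"
| "unfreeze N (Fun f ts) =
     (if N \<le> fst f then Var (fst f - N) else Fun f (map (unfreeze N) ts))"

lemma unfreeze_freeze:
  assumes "t \<in> terms \<Sigma>" "\<And>f. f \<in> \<Sigma> \<Longrightarrow> fst f < N"
  shows "unfreeze N (freeze N t) = t"
  using assms by (induction t) (force simp: freeze_def fresh_def terms_Fun_iff intro!: map_idI)+

text \<open>No symbol of \<open>t\<close> has a fresh name, so unfreezing passes through
  \<open>t\<close> to the substituted terms; instances of rules stay instances.\<close>

lemma unfreeze_subst:
  assumes "t \<in> terms \<Sigma>" "\<And>f. f \<in> \<Sigma> \<Longrightarrow> fst f < N"
  shows "unfreeze N (subst \<sigma> t) = subst (\<lambda>x. unfreeze N (\<sigma> x)) t"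
  using assms by (induction t) (force simp: terms_Fun_iff)+

text \<open>Alphabets are finite, so only the variables below a bound receive constants.\<close>

definition freeze_alphabet :: "nat \<Rightarrow> nat \<Rightarrow> symbol set \<Rightarrow> symbol set" where
  "freeze_alphabet N k \<Sigma> = \<Sigma> \<union> fresh N ` {..<k}"

lemma unfreeze_in_terms:
  assumes "t \<in> terms (freeze_alphabet N k \<Sigma>)"
  shows "unfreeze N t \<in> terms \<Sigma>"
  using assms
  by (induction t) (auto simp: terms_Fun_iff freeze_alphabet_def fresh_def intro: terms.Var)

lemma freeze_in_terms:
  assumes "t \<in> terms \<Sigma>" "vars t \<subseteq> {..<k}"
  shows "freeze N t \<in> terms (freeze_alphabet N k \<Sigma>)"
  unfolding freeze_def
proof (rule subst_in_terms)
  show "t \<in> terms (freeze_alphabet N k \<Sigma>)"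
    using assms(1) by (rule terms_mono) (auto simp: freeze_alphabet_def)
qed (use assms(2) in \<open>auto simp: terms_Fun_iff freeze_alphabet_def fresh_def\<close>)

lemma vars_freeze [simp]: "vars (freeze N t) = {}"
  by (simp add: freeze_def vars_subst)

text \<open>A root step remains an instance of the same rule. A step in an argument survives or,
  below a fresh name, vanishes; hence the reflexive closure.\<close>

lemma rewr_unfreeze:
  assumes "rewr R s t" "trs \<Sigma> R" "\<And>f. f \<in> \<Sigma> \<Longrightarrow> fst f < N"
  shows "(rewr R)\<^sup>=\<^sup>= (unfreeze N s) (unfreeze N t)"
  using assms(1)
proof induction
  case (root l r \<sigma>)
  then have "l \<in> terms \<Sigma>" "r \<in> terms \<Sigma>" using assms(2) by (auto simp: trs_def)
  then show ?case
    using root assms(3) by (auto simp: unfreeze_subst[of _ \<Sigma>] intro: rewr.root)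
next
  case (arg s t f ss ts)
  then show ?case by (auto intro: rewr.arg)
qed

lemma rstep_freeze:
  assumes "(rstep \<Sigma> R)\<^sup>*\<^sup>* s t" "trs \<Sigma> R" "vars s \<subseteq> {..<k}"
  shows "(rstep (freeze_alphabet N k \<Sigma>) R)\<^sup>*\<^sup>* (freeze N s) (freeze N t)"
proof -
  \<comment> \<open>The variable bound joins the induction because a frozen reduct is a term over
    the finite extended alphabet only while its variables stay below \<open>k\<close>.\<close>
  have "vars t \<subseteq> {..<k} \<and> (rstep (freeze_alphabet N k \<Sigma>) R)\<^sup>*\<^sup>* (freeze N s) (freeze N t)"
    using assms(1)
  proof induction
    case (step t u)
    then have "rstep (freeze_alphabet N k \<Sigma>) R (freeze N t) (freeze N u)"
      using rewr_vars[OF _ assms(2), of t u] rewr_subst[of R t u "\<lambda>x. const (fresh N x)", folded freeze_def]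
      by (auto simp: rstep_def intro!: freeze_in_terms)
    moreover have "vars u \<subseteq> {..<k}"
      using step rewr_vars[OF _ assms(2), of t u] by (auto simp: rstep_def)
    ultimately show ?case
      using step.IH by (auto intro: rtranclp.rtrancl_into_rtrancl)
  qed (use assms(3) in simp)
  then show ?thesis by simp
qed

lemma rstep_unfreeze:
  assumes "(rstep (freeze_alphabet N k \<Sigma>) R)\<^sup>*\<^sup>* s t" "trs \<Sigma> R" "\<And>f. f \<in> \<Sigma> \<Longrightarrow> fst f < N"
  shows "(rstep \<Sigma> R)\<^sup>*\<^sup>* (unfreeze N s) (unfreeze N t)"
  using assms(1)
proof induction
  case (step t u)
  then have "(rstep \<Sigma> R)\<^sup>=\<^sup>= (unfreeze N t) (unfreeze N u)"
    using rewr_unfreeze[OF _ assms(2,3), of t u] unfreeze_in_terms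
    by (auto simp: rstep_def)
  with step.IH show ?case by auto
qed simp

text \<open>Confluence turns convertibility into a common reduct over \<open>\<Sigma>\<close>.
  Freezing moves that reduct to the extended alphabet and unfreezing moves any common descendant
  back, restoring \<open>p\<close> and \<open>q\<close>.\<close>

lemma equivclp_iff_descendants:
  assumes "trs \<Sigma> R" "confluentp (rstep \<Sigma> R)" "\<And>f. f \<in> \<Sigma> \<Longrightarrow> fst f < N"
    and "p \<in> terms \<Sigma>" "q \<in> terms \<Sigma>" "vars p \<subseteq> {..<k}" "vars q \<subseteq> {..<k}"
  defines "\<Delta> \<equiv> freeze_alphabet N k \<Sigma>"
  shows "equivclp (rstep \<Sigma> R) p q \<longleftrightarrow>
    descendants \<Delta> R {freeze N p} \<inter> descendants \<Delta> R {freeze N q} \<noteq> {}"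
proof
  assume "equivclp (rstep \<Sigma> R) p q"
  then obtain s where "(rstep \<Sigma> R)\<^sup>*\<^sup>* p s" "(rstep \<Sigma> R)\<^sup>*\<^sup>* q s"
    using semiconfluentp_equivclp[OF confluentp_imp_semiconfluentp[OF assms(2)]]
    by (auto simp: rtranclp_conversep)
  then have "freeze N s \<in> descendants \<Delta> R {freeze N p} \<inter> descendants \<Delta> R {freeze N q}"
    using assms by (auto simp: descendants_def intro: rstep_freeze)
  then show "descendants \<Delta> R {freeze N p} \<inter> descendants \<Delta> R {freeze N q} \<noteq> {}" by blast
next
  assume "descendants \<Delta> R {freeze N p} \<inter> descendants \<Delta> R {freeze N q} \<noteq> {}"
  then obtain s where "(rstep \<Delta> R)\<^sup>*\<^sup>* (freeze N p) s" "(rstep \<Delta> R)\<^sup>*\<^sup>* (freeze N q) s"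
    by (auto simp: descendants_def)
  then have "(rstep \<Sigma> R)\<^sup>*\<^sup>* p (unfreeze N s)" "(rstep \<Sigma> R)\<^sup>*\<^sup>* q (unfreeze N s)"
    using rstep_unfreeze[OF _ assms(1,3), of k _ s] assms(4,5) unfreeze_freeze[OF _ assms(3)]
    by (force simp: \<Delta>_def)+
  then show "equivclp (rstep \<Sigma> R) p q"
    using semiconfluentp_equivclp[OF confluentp_imp_semiconfluentp[OF assms(2)]]
    by (auto simp: rtranclp_conversep)
qed

section \<open>Intersection of two automata\<close>

text \<open>The second and third disjunct are
  meant for epsilon moves of one of the two components. The rule of the other component then only
  says that its state is a right-hand side, which all reachable states are.\<close>

definition pair_closed :: "symbol set \<Rightarrow> trs \<Rightarrow> trs \<Rightarrow> (trm \<times> trm) set \<Rightarrow> bool" where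
  "pair_closed \<Sigma> R1 R2 S \<longleftrightarrow> (\<forall>(l1, r1) \<in> R1. \<forall>(l2, r2) \<in> R2.
     (\<exists>f us vs. f \<in> \<Sigma> \<and> l1 = Fun f us \<and> l2 = Fun f vs \<and> list_all2 (\<lambda>u v. (u, v) \<in> S) us vs) \<or>
     (l1, r2) \<in> S \<or> (r1, l2) \<in> S \<longrightarrow> (r1, r2) \<in> S)"

lemma pair_closedI:
  assumes "\<And>l1 r1 l2 r2 f us vs. (l1, r1) \<in> R1 \<Longrightarrow> (l2, r2) \<in> R2 \<Longrightarrow> f \<in> \<Sigma> \<Longrightarrow> l1 = Fun f us \<Longrightarrow>
      l2 = Fun f vs \<Longrightarrow> list_all2 (\<lambda>u v. (u, v) \<in> S) us vs \<Longrightarrow> (r1, r2) \<in> S"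
    and "\<And>l1 r1 l2 r2. (l1, r1) \<in> R1 \<Longrightarrow> (l2, r2) \<in> R2 \<Longrightarrow> (l1, r2) \<in> S \<Longrightarrow> (r1, r2) \<in> S"
    and "\<And>l1 r1 l2 r2. (l1, r1) \<in> R1 \<Longrightarrow> (l2, r2) \<in> R2 \<Longrightarrow> (r1, l2) \<in> S \<Longrightarrow> (r1, r2) \<in> S"
  shows "pair_closed \<Sigma> R1 R2 S"
proof -
  have "(r1, r2) \<in> S"
    if "(l1, r1) \<in> R1" "(l2, r2) \<in> R2"
      "(\<exists>f us vs. f \<in> \<Sigma> \<and> l1 = Fun f us \<and> l2 = Fun f vs \<and> list_all2 (\<lambda>u v. (u, v) \<in> S) us vs) \<or>
       (l1, r2) \<in> S \<or> (r1, l2) \<in> S" for l1 r1 l2 r2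
    using that(3) assms(1)[OF that(1,2)] assms(2,3)[OF that(1,2)] by blast
  then show ?thesis unfolding pair_closed_def by blast
qed

lemma pair_closedD:
  assumes "pair_closed \<Sigma> R1 R2 S" "(l1, r1) \<in> R1" "(l2, r2) \<in> R2"
    and "(\<exists>f us vs. f \<in> \<Sigma> \<and> l1 = Fun f us \<and> l2 = Fun f vs \<and> list_all2 (\<lambda>u v. (u, v) \<in> S) us vs) \<or>
       (l1, r2) \<in> S \<or> (r1, l2) \<in> S"
  shows "(r1, r2) \<in> S"
  using bspec[OF bspec[OF assms(1)[unfolded pair_closed_def] assms(2), simplified] assms(3)] assms(4) by auto

section \<open>Rules and runs of an automaton\<close>

lemma bta_rule_cases:
  assumes "is_bta \<Sigma> C" "(l, r) \<in> rules C"
  obtains (symbol) f as a where "f \<in> \<Sigma>" "length as = rank f" "set as \<subseteq> states C" "a \<in> states C"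
      "l = Fun f (map const as)" "r = const a"
    | (epsilon) a a' where "a \<in> states C" "a' \<in> states C" "l = const a" "r = const a'"
  using assms unfolding is_bta_def by (metis (no_types, lifting) prod.inject)

text \<open>The left-hand side of an epsilon move is a state, and states are disjoint from
  \<open>\<Sigma>\<close>.\<close>

lemma bta_symbol_rule:
  assumes "is_bta \<Sigma> C" "(Fun f us, r) \<in> rules C" "f \<in> \<Sigma>"
  obtains as a where "us = map const as" "length as = rank f" "set as \<subseteq> states C" "r = const a" "a \<in> states C"
  using that assms(1,3) by (cases rule: bta_rule_cases[OF assms(1,2)]) (auto simp: is_bta_def)

abbreviation bta_step :: "symbol set \<Rightarrow> bta \<Rightarrow> trm \<Rightarrow> trm \<Rightarrow> bool" where
  "bta_step \<Sigma> C \<equiv> rstep (\<Sigma> \<union> states C) (rules C)"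

text \<open>Automaton rules are ground, so matching is equality.\<close>

lemma bta_rule_subst:
  assumes "is_bta \<Sigma> C" "(l, r) \<in> rules C"
  shows "subst \<sigma> l = l" "subst \<sigma> r = r"
  using assms by (auto elim!: bta_rule_cases)

lemma bta_step_rule:
  assumes "is_bta \<Sigma> C" "(l, r) \<in> rules C"
  shows "bta_step \<Sigma> C l r"
proof -
  have "rewr (rules C) l r"
    using rewr.root[OF assms(2), of Var] by (simp add: bta_rule_subst[OF assms])
  moreover have "const a \<in> terms (\<Sigma> \<union> states C)" if "a \<in> states C" for a
    using that assms(1) by (auto simp: terms_Fun_iff is_bta_def)
  ultimately show ?thesis
    by (cases rule: bta_rule_cases[OF assms]) (auto simp: rstep_def terms_Fun_iff)
qed

lemma rstep_arg:
  assumes "rstep \<Sigma> R s t" "Fun f (ss @ s # ts) \<in> terms \<Sigma>"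
  shows "rstep \<Sigma> R (Fun f (ss @ s # ts)) (Fun f (ss @ t # ts))"
  using assms by (auto simp: rstep_def terms_Fun_iff intro: rewr.arg)

lemma rsteps_in_terms: "(rstep \<Sigma> R)\<^sup>*\<^sup>* s t \<Longrightarrow> s \<in> terms \<Sigma> \<Longrightarrow> t \<in> terms \<Sigma>"
  by (induction rule: rtranclp_induct) (auto simp: rstep_def)

lemma rsteps_arg:
  assumes "(rstep \<Sigma> R)\<^sup>*\<^sup>* s t" "Fun f (ss @ s # ts) \<in> terms \<Sigma>"
  shows "(rstep \<Sigma> R)\<^sup>*\<^sup>* (Fun f (ss @ s # ts)) (Fun f (ss @ t # ts))"
  using assms(1)
proof induction
  case (step t u)
  have "t \<in> terms \<Sigma>" using step.hyps by (simp add: rstep_def)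
  then have "rstep \<Sigma> R (Fun f (ss @ t # ts)) (Fun f (ss @ u # ts))"
    using step.hyps assms(2) by (intro rstep_arg) (auto simp: terms_Fun_iff)
  with step.IH show ?case by simp
qed simp

text \<open>Arguments are reduced from left to right; \<open>us\<close> collects those already
  done.\<close>

lemma rsteps_args:
  assumes "list_all2 (rstep \<Sigma> R)\<^sup>*\<^sup>* ss ts" "Fun f (us @ ss) \<in> terms \<Sigma>"
  shows "(rstep \<Sigma> R)\<^sup>*\<^sup>* (Fun f (us @ ss)) (Fun f (us @ ts))"
  using assms
proof (induction arbitrary: us rule: list_all2_induct)
  case (Cons s ss t ts)
  have "t \<in> terms \<Sigma>"
    using Cons.hyps Cons.prems by (auto simp: terms_Fun_iff intro: rsteps_in_terms)
  then have "(rstep \<Sigma> R)\<^sup>*\<^sup>* (Fun f (us @ t # ss)) (Fun f (us @ t # ts))"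
    using Cons.IH[of "us @ [t]"] Cons.prems by (simp add: terms_Fun_iff)
  with rsteps_arg[OF Cons.hyps(1) Cons.prems] show ?case by simp
qed simp

lemma bta_step_args_or_root:
  assumes "is_bta \<Sigma> C" "rewr (rules C) (Fun f ss) t"
  obtains (root) "(Fun f ss, t) \<in> rules C"
    | (arg) us s s' vs where "ss = us @ s # vs" "t = Fun f (us @ s' # vs)" "rewr (rules C) s s'"
  using assms(2)
proof cases
  case (root l r \<sigma>)
  then show ?thesis using that(1) bta_rule_subst[OF assms(1) root(3)] by simp
qed (use that(2) in auto)

text \<open>A run ending in a state must consume the root symbol at some point, and all steps before
  that take place inside the arguments. Induction prepends each such step to the run of its
  argument.\<close>

lemma bta_decompose:
  assumes "is_bta \<Sigma> C" "(bta_step \<Sigma> C)\<^sup>*\<^sup>* (Fun f ss) (const a)" "f \<in> \<Sigma>" "a \<in> states C"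
  obtains us b where "list_all2 (bta_step \<Sigma> C)\<^sup>*\<^sup>* ss us" "(Fun f us, b) \<in> rules C"
    "(bta_step \<Sigma> C)\<^sup>*\<^sup>* b (const a)"
proof -
  have "\<exists>us b. list_all2 (bta_step \<Sigma> C)\<^sup>*\<^sup>* ss us \<and> (Fun f us, b) \<in> rules C \<and> (bta_step \<Sigma> C)\<^sup>*\<^sup>* b (const a)"
    using assms(2)
  proof (induction "Fun f ss" arbitrary: ss rule: converse_rtranclp_induct)
    case base
    \<comment> \<open>An empty run is impossible: \<open>f\<close> is in \<open>\<Sigma>\<close>,
      whereas \<open>a\<close> is a state.\<close>
    then show ?case using assms(1,3,4) by (auto simp: is_bta_def)
  next
    case (step t)
    have "rewr (rules C) (Fun f ss) t" using step.hyps by (simp add: rstep_def)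
    with assms(1) show ?case
    proof (cases rule: bta_step_args_or_root)
      case root
      with step.hyps show ?thesis by (auto intro!: exI[of _ ss] simp: list.rel_refl)
    next
      case (arg us s s' vs)
      obtain ws b where *: "list_all2 (bta_step \<Sigma> C)\<^sup>*\<^sup>* (us @ s' # vs) ws" "(Fun f ws, b) \<in> rules C"
        "(bta_step \<Sigma> C)\<^sup>*\<^sup>* b (const a)"
        using step.hyps(3) arg(2) by blast
      have "bta_step \<Sigma> C s s'"
        using step.hyps(1) arg by (auto simp: rstep_def terms_Fun_iff)
      then have "list_all2 (bta_step \<Sigma> C)\<^sup>*\<^sup>* ss (us @ s' # vs)"
        unfolding arg(1) by (intro list_all2_appendI list.rel_refl) (auto intro: list.rel_refl)
      then have "list_all2 (bta_step \<Sigma> C)\<^sup>*\<^sup>* ss ws"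
        using *(1) by (rule list_all2_trans[rotated]) auto
      with * show ?thesis by blast
    qed
  qed
  with that show ?thesis by blast
qed

lemma rewr_const:
  assumes "is_bta \<Sigma> C" "rewr (rules C) (const a) t"
  shows "(const a, t) \<in> rules C"
  by (cases rule: bta_step_args_or_root[OF assms]) auto

section \<open>Every closed set contains all jointly reached pairs of states\<close>

lemma pair_closed_converse:
  assumes "pair_closed \<Sigma> R1 R2 S"
  shows "pair_closed \<Sigma> R2 R1 (S\<inverse>)"
proof (rule pair_closedI)
  fix l1 r1 l2 r2 f us vs
  assume r: "(l1, r1) \<in> R2" "(l2, r2) \<in> R1" and f: "f \<in> \<Sigma>" "l1 = Fun f us" "l2 = Fun f vs"
    and all: "list_all2 (\<lambda>u v. (u, v) \<in> S\<inverse>) us vs"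
  have "list_all2 (\<lambda>u v. (u, v) \<in> S) vs us"
    using all by (auto simp: list_all2_conv_all_nth)
  with f show "(r1, r2) \<in> S\<inverse>"
    using pair_closedD[OF assms r(2,1)] by blast
qed (use pair_closedD[OF assms] in blast)+

text \<open>From \<open>c\<close> only epsilon moves are possible, and each is paired with the rule
  producing \<open>d\<close>. The invariant that the current term is a right-hand side makes it a
  state and lets it serve as the fixed partner when the other component moves.\<close>

lemma pair_closed_rsteps:
  assumes "is_bta \<Sigma> C" "pair_closed \<Sigma> (rules C) R S"
    and "(l, c) \<in> rules C" "(m, d) \<in> R" "(c, d) \<in> S" "(bta_step \<Sigma> C)\<^sup>*\<^sup>* c a"
  shows "(a, d) \<in> S \<and> (\<exists>l. (l, a) \<in> rules C)"
  using assms(6)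
proof induction
  case base
  with assms show ?case by blast
next
  case (step t u)
  then obtain l where "(t, d) \<in> S" "(l, t) \<in> rules C" by blast
  moreover obtain b where "t = const b"
    by (rule bta_rule_cases[OF assms(1) \<open>(l, t) \<in> rules C\<close>]) auto
  then have "(t, u) \<in> rules C"
    using step.hyps(2) rewr_const[OF assms(1)] by (simp add: rstep_def)
  ultimately show ?case
    using pair_closedD[OF assms(2) _ assms(4)] by blast
qed

text \<open>Both runs split at the root symbol: the induction hypothesis covers the arguments, one
  symbol rule of each automaton fires, then the epsilon moves of \<open>C\<close> follow and finally
  those of \<open>D\<close>.\<close>

lemma pair_closed_reached:
  assumes "is_bta \<Sigma> C" "is_bta \<Sigma> D" "pair_closed \<Sigma> (rules C) (rules D) S"
    and "t \<in> ground_terms \<Sigma>" "a \<in> states C" "b \<in> states D"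
    and "(bta_step \<Sigma> C)\<^sup>*\<^sup>* t (const a)" "(bta_step \<Sigma> D)\<^sup>*\<^sup>* t (const b)"
  shows "(const a, const b) \<in> S"
  using assms(4-)
proof (induction t arbitrary: a b)
  case (Var x)
  then show ?case by (simp add: ground_terms_def)
next
  case (Fun f ts)
  have f: "f \<in> \<Sigma>" and ts: "set ts \<subseteq> ground_terms \<Sigma>"
    using Fun.prems(1) by (auto simp: ground_terms_def terms_Fun_iff)
  obtain us c where c: "list_all2 (bta_step \<Sigma> C)\<^sup>*\<^sup>* ts us" "(Fun f us, c) \<in> rules C"
    "(bta_step \<Sigma> C)\<^sup>*\<^sup>* c (const a)"
    by (rule bta_decompose[OF assms(1) Fun.prems(4) f Fun.prems(2)]) (rule that)
  obtain vs d where d: "list_all2 (bta_step \<Sigma> D)\<^sup>*\<^sup>* ts vs" "(Fun f vs, d) \<in> rules D"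
    "(bta_step \<Sigma> D)\<^sup>*\<^sup>* d (const b)"
    by (rule bta_decompose[OF assms(2) Fun.prems(5) f Fun.prems(3)]) (rule that)
  obtain as c' where as: "us = map const as" "set as \<subseteq> states C" "c = const c'" "c' \<in> states C"
    by (rule bta_symbol_rule[OF assms(1) c(2) f]) (rule that)
  obtain bs d' where bs: "vs = map const bs" "set bs \<subseteq> states D" "d = const d'" "d' \<in> states D"
    by (rule bta_symbol_rule[OF assms(2) d(2) f]) (rule that)
  have "list_all2 (\<lambda>u v. (u, v) \<in> S) us vs"
  proof (rule list_all2_all_nthI)
    show "length us = length vs"
      using c(1) d(1) by (metis list_all2_lengthD)
    fix i assume i: "i < length us"
    then have "i < length ts" using c(1) by (simp add: list_all2_lengthD)
    then have "as ! i \<in> states C" "bs ! i \<in> states D" "ts ! i \<in> ground_terms \<Sigma>"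
      using i nth_mem[of i as] nth_mem[of i bs] nth_mem[of i ts] ts as bs \<open>length us = length vs\<close> by auto
    with i \<open>i < length ts\<close> show "(us ! i, vs ! i) \<in> S"
      using Fun.IH[of "ts ! i" "as ! i" "bs ! i"] as bs \<open>length us = length vs\<close>
        list_all2_nthD[OF c(1), of i] list_all2_nthD[OF d(1), of i]
      by simp
  qed
  with f have "(c, d) \<in> S"
    using pair_closedD[OF assms(3) c(2) d(2)] by blast
  then have "(const a, d) \<in> S"
    using pair_closed_rsteps[OF assms(1,3) c(2) d(2) _ c(3)] by blast
  \<comment> \<open>For the moves of \<open>D\<close> the partner is \<open>const a\<close>, so it
    must be a right-hand side in \<open>C\<close>; the roles are exchanged by passing to the
    converse of \<open>S\<close>.\<close>
  moreover obtain l where "(l, const a) \<in> rules C"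
    using pair_closed_rsteps[OF assms(1,3) c(2) d(2) \<open>(c, d) \<in> S\<close> c(3)] by blast
  ultimately have "(const b, const a) \<in> S\<inverse>"
    using pair_closed_rsteps[OF assms(2) pair_closed_converse[OF assms(3)] d(2) _ _ d(3)] by blast
  then show ?case by simp
qed

section \<open>The reachable pairs form a closed set\<close>

lemma list_all2_common_source:
  assumes "list_all2 (\<lambda>u v. \<exists>t \<in> T. P t u \<and> Q t v) us vs"
  shows "\<exists>ts. set ts \<subseteq> T \<and> list_all2 P ts us \<and> list_all2 Q ts vs"
  using assms
proof induction
  case (Cons u us v vs)
  then obtain t ts where "t \<in> T" "P t u" "Q t v" "set ts \<subseteq> T" "list_all2 P ts us" "list_all2 Q ts vs"
    by blast
  then show ?case by (intro exI[of _ "t # ts"]) simp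
qed simp

lemma bta_step_symbol_rule:
  assumes "is_bta \<Sigma> C" "(Fun f us, r) \<in> rules C" "f \<in> \<Sigma>"
    and "set ts \<subseteq> ground_terms \<Sigma>" "list_all2 (bta_step \<Sigma> C)\<^sup>*\<^sup>* ts us"
  shows "Fun f ts \<in> ground_terms \<Sigma>" "(bta_step \<Sigma> C)\<^sup>*\<^sup>* (Fun f ts) r"
proof -
  have "length ts = rank f"
    by (rule bta_symbol_rule[OF assms(1-3)]) (use list_all2_lengthD[OF assms(5)] in simp)
  then show *: "Fun f ts \<in> ground_terms \<Sigma>"
    using assms(3,4) by (auto simp: ground_terms_def terms_Fun_iff)
  then have "Fun f ts \<in> terms (\<Sigma> \<union> states C)"
    by (auto simp: ground_terms_def intro: terms_mono)
  then have "(bta_step \<Sigma> C)\<^sup>*\<^sup>* (Fun f ts) (Fun f us)"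
    using rsteps_args[OF assms(5), of f "[]"] by simp
  then show "(bta_step \<Sigma> C)\<^sup>*\<^sup>* (Fun f ts) r"
    using bta_step_rule[OF assms(1,2)] by simp
qed

text \<open>A common term forces its pair of final states into every closed set. Conversely the
  condition is applied to the set of pairs with a common ground source, which is closed. Restricting
  to right-hand sides keeps the candidates finite in number.\<close>

theorem lang_inter_nonempty_iff:
  assumes "is_bta \<Sigma> C" "is_bta \<Sigma> D"
  shows "lang \<Sigma> C \<inter> lang \<Sigma> D \<noteq> {} \<longleftrightarrow>
    (\<forall>S \<subseteq> snd ` rules C \<times> snd ` rules D. pair_closed \<Sigma> (rules C) (rules D) S \<longrightarrow>
      (\<exists>a \<in> finals C. \<exists>b \<in> finals D. (const a, const b) \<in> S))"
    (is "?L \<longleftrightarrow> ?R")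
proof
  assume ?L
  then obtain t a b where *: "t \<in> ground_terms \<Sigma>" "a \<in> finals C" "b \<in> finals D"
    "(bta_step \<Sigma> C)\<^sup>*\<^sup>* t (const a)" "(bta_step \<Sigma> D)\<^sup>*\<^sup>* t (const b)"
    by (auto simp: lang_def)
  then have "a \<in> states C" "b \<in> states D"
    using assms by (auto simp: is_bta_def)
  with * show ?R
    using pair_closed_reached[OF assms] by blast
next
  define reach where "reach u v \<longleftrightarrow>
      (\<exists>t \<in> ground_terms \<Sigma>. (bta_step \<Sigma> C)\<^sup>*\<^sup>* t u \<and> (bta_step \<Sigma> D)\<^sup>*\<^sup>* t v)" for u v
  define S where "S = {(u, v). u \<in> snd ` rules C \<and> v \<in> snd ` rules D \<and> reach u v}"
  have S: "(r1, r2) \<in> S" if "(l1, r1) \<in> rules C" "(l2, r2) \<in> rules D" "reach r1 r2" for l1 r1 l2 r2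
    using that image_eqI[of r1 snd "(l1, r1)"] image_eqI[of r2 snd "(l2, r2)"] by (simp add: S_def)
  have reach: "reach u v" if "(u, v) \<in> S" for u v
    using that by (simp add: S_def)
  have closed: "pair_closed \<Sigma> (rules C) (rules D) S"
  proof (rule pair_closedI)
    fix l1 r1 l2 r2 f us vs
    assume r: "(l1, r1) \<in> rules C" "(l2, r2) \<in> rules D" and f: "f \<in> \<Sigma>" "l1 = Fun f us" "l2 = Fun f vs"
      and all: "list_all2 (\<lambda>u v. (u, v) \<in> S) us vs"
    have "list_all2 reach us vs" using all by (rule list_all2_mono) (rule reach)
    from list_all2_common_source[OF this[unfolded reach_def]] obtain ts where ts: "set ts \<subseteq> ground_terms \<Sigma>"
      "list_all2 (bta_step \<Sigma> C)\<^sup>*\<^sup>* ts us" "list_all2 (bta_step \<Sigma> D)\<^sup>*\<^sup>* ts vs" by auto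
    have "reach r1 r2"
      unfolding reach_def
      using bta_step_symbol_rule[OF assms(1) r(1)[unfolded f(2)] f(1) ts(1,2)]
        bta_step_symbol_rule[OF assms(2) r(2)[unfolded f(3)] f(1) ts(1,3)] by auto
    with r show "(r1, r2) \<in> S" by (rule S)
  next
    fix l1 r1 l2 r2
    assume r: "(l1, r1) \<in> rules C" "(l2, r2) \<in> rules D" and "(l1, r2) \<in> S"
    then obtain t where t: "t \<in> ground_terms \<Sigma>" "(bta_step \<Sigma> C)\<^sup>*\<^sup>* t l1" "(bta_step \<Sigma> D)\<^sup>*\<^sup>* t r2"
      using reach unfolding reach_def by auto
    have "(bta_step \<Sigma> C)\<^sup>*\<^sup>* t r1"
      using t(2) bta_step_rule[OF assms(1) r(1)] by (rule rtranclp.rtrancl_into_rtrancl)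
    with t have "reach r1 r2" unfolding reach_def by auto
    with r show "(r1, r2) \<in> S" by (rule S)
  next
    fix l1 r1 l2 r2
    assume r: "(l1, r1) \<in> rules C" "(l2, r2) \<in> rules D" and "(r1, l2) \<in> S"
    then obtain t where t: "t \<in> ground_terms \<Sigma>" "(bta_step \<Sigma> C)\<^sup>*\<^sup>* t r1" "(bta_step \<Sigma> D)\<^sup>*\<^sup>* t l2"
      using reach unfolding reach_def by auto
    have "(bta_step \<Sigma> D)\<^sup>*\<^sup>* t r2"
      using t(3) bta_step_rule[OF assms(2) r(2)] by (rule rtranclp.rtrancl_into_rtrancl)
    with t have "reach r1 r2" unfolding reach_def by auto
    with r show "(r1, r2) \<in> S" by (rule S)
  qed
  assume ?R
  moreover have "S \<subseteq> snd ` rules C \<times> snd ` rules D" by (auto simp: S_def)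
  ultimately obtain a b where "a \<in> finals C" "b \<in> finals D" "(const a, const b) \<in> S"
    using closed by metis
  then show ?L using reach by (auto simp: lang_def reach_def)
qed

section \<open>Deciding intersection on codes\<close>

text \<open>Even numbers code variables and odd ones function terms; halving an odd code leaves the
  pair of root symbol and argument list.\<close>

abbreviation code_root :: "nat \<Rightarrow> nat" where
  "code_root n \<equiv> fst (prod_decode (n div 2))"

abbreviation code_args :: "nat \<Rightarrow> nat" where
  "code_args n \<equiv> snd (prod_decode (n div 2))"

lemma code_trm_Fun: "code_trm (Fun f ts) = Suc (2 * prod_encode (code_symbol f, list_encode (map code_trm ts)))"
  by (simp add: sum_encode_def)

lemma code_trm_Var: "code_trm (Var x) = 2 * x"
  by (simp add: sum_encode_def)

lemma codes_set_list_decode: "codes_set c m A \<Longrightarrow> set (list_decode m) = c ` A"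
  by (auto simp: codes_set_def)

lemma code_trm_eq_iff [simp]: "code_trm s = code_trm t \<longleftrightarrow> s = t"
  by (rule inj_eq[OF inj_code_trm])

text \<open>This is \<open>pair_closed\<close> read on codes, with \<open>S\<close> given by the
  binary ones of \<open>s\<close>. Projections replace the unbounded choice of \<open>f\<close>,
  \<open>us\<close> and \<open>vs\<close>, so only bounded quantifiers remain.\<close>

definition code_closed :: "nat \<Rightarrow> nat \<Rightarrow> nat \<Rightarrow> nat \<Rightarrow> bool" where
  "code_closed m k1 k2 s \<longleftrightarrow>
     (\<forall>\<rho> \<in> set (list_decode k1). \<forall>\<tau> \<in> set (list_decode k2).
        (odd (fst (prod_decode \<rho>)) \<and> odd (fst (prod_decode \<tau>)) \<and>
         code_root (fst (prod_decode \<rho>)) = code_root (fst (prod_decode \<tau>)) \<and>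
         code_root (fst (prod_decode \<rho>)) \<in> set (list_decode m) \<and>
         list_all2 (\<lambda>a b. prod_encode (a, b) \<in> set_decode s)
           (list_decode (code_args (fst (prod_decode \<rho>)))) (list_decode (code_args (fst (prod_decode \<tau>)))) \<or>
         prod_encode (fst (prod_decode \<rho>), snd (prod_decode \<tau>)) \<in> set_decode s \<or>
         prod_encode (snd (prod_decode \<rho>), fst (prod_decode \<tau>)) \<in> set_decode s) \<longrightarrow>
        prod_encode (snd (prod_decode \<rho>), snd (prod_decode \<tau>)) \<in> set_decode s)"

definition decode_pairs :: "nat \<Rightarrow> (trm \<times> trm) set" where
  "decode_pairs s = {(u, v). prod_encode (code_trm u, code_trm v) \<in> set_decode s}"

lemma code_closed_iff:
  assumes "codes_set code_symbol m \<Sigma>" "codes_set code_rule k1 R1" "codes_set code_rule k2 R2"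
  shows "code_closed m k1 k2 s \<longleftrightarrow> pair_closed \<Sigma> R1 R2 (decode_pairs s)"
proof -
  have "odd (code_trm l1) \<and> odd (code_trm l2) \<and> code_root (code_trm l1) = code_root (code_trm l2) \<and>
      code_root (code_trm l1) \<in> code_symbol ` \<Sigma> \<and>
      list_all2 (\<lambda>a b. prod_encode (a, b) \<in> set_decode s)
        (list_decode (code_args (code_trm l1))) (list_decode (code_args (code_trm l2))) \<longleftrightarrow>
      (\<exists>f us vs. f \<in> \<Sigma> \<and> l1 = Fun f us \<and> l2 = Fun f vs \<and> list_all2 (\<lambda>u v. (u, v) \<in> decode_pairs s) us vs)"
    for l1 l2
    by (cases l1; cases l2)
      (auto simp: code_trm_Fun code_trm_Var list_all2_map1 list_all2_map2 decode_pairs_def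
        simp del: code_trm.simps)
  then show ?thesis
    unfolding code_closed_def pair_closed_def assms[THEN codes_set_list_decode]
    by (simp add: code_rule_def split_beta decode_pairs_def)
qed

definition code_finals :: "nat \<Rightarrow> nat" where
  "code_finals c = fst (prod_decode (snd (prod_decode c)))"

definition code_rules :: "nat \<Rightarrow> nat" where
  "code_rules c = snd (prod_decode (snd (prod_decode c)))"

text \<open>Right-hand sides have codes below the code of the rule list, so a pair of them has a
  position below \<open>prod_encode (code_rules c, code_rules d)\<close> and a set of such pairs is
  a number below that power of 2. The numbers \<open>Suc (2 * prod_encode (a, 0))\<close> are codes
  of constants, 0 being the empty argument list.\<close>

definition code_inter :: "nat \<Rightarrow> nat \<Rightarrow> nat \<Rightarrow> bool" where
  "code_inter m c d \<longleftrightarrow>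
     (\<forall>s < 2 ^ prod_encode (code_rules c, code_rules d). code_closed m (code_rules c) (code_rules d) s \<longrightarrow>
        (\<exists>a \<in> set (list_decode (code_finals c)). \<exists>b \<in> set (list_decode (code_finals d)).
           prod_encode (Suc (2 * prod_encode (a, 0)), Suc (2 * prod_encode (b, 0))) \<in> set_decode s))"

lemma decidable_code_inter [computable_intros]:
  assumes "computable f" "computable g" "computable h"
  shows "decidable (\<lambda>xs. code_inter (f xs) (g xs) (h xs))"
proof (rule decidable_subst3[OF _ assms, of code_inter])
  show "decidable (\<lambda>xs. code_inter (arg 0 xs) (arg 1 xs) (arg 2 xs))"
    unfolding code_inter_def code_closed_def code_rules_def code_finals_def
    by (intro computable_intros)
qed

section \<open>Size bounds and correctness of the enumeration\<close>

lemma prod_encode_less: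
  assumes "a < c" "b < d"
  shows "prod_encode (a, b) < prod_encode (c, d)"
proof -
  have "triangle i \<le> triangle j" if "i \<le> j" for i j
    using that by (induction rule: dec_induct) auto
  from this[of "a + b" "c + d"] show ?thesis
    using assms by (simp add: prod_encode_def)
qed

lemma set_encode_less:
  assumes "A \<subseteq> {..<k}"
  shows "set_encode A < 2 ^ k"
proof -
  have "set_encode A \<le> set_encode {..<k}"
    unfolding set_encode_def using assms by (intro sum_mono2) auto
  also have "\<dots> < 2 ^ k"
    by (induction k) (auto simp: lessThan_Suc)
  finally show ?thesis .
qed

lemma code_rhs_less:
  assumes "codes_set code_rule k R" "u \<in> snd ` R"
  shows "code_trm u < k"
proof -
  obtain l where "code_rule (l, u) \<in> set (list_decode k)"
    using assms by (force simp: codes_set_list_decode)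
  then have "code_rule (l, u) < k"
    using less_list_encode[of _ "list_decode k"] by simp
  then show ?thesis
    using le_prod_encode_2[of "code_trm u" "code_trm l"] by (simp add: code_rule_def)
qed

text \<open>Bit patterns below the bound may contain other pairs too. Cutting them away is harmless:
  the premises of the closure condition only get stronger, and what it adds is always a pair of
  right-hand sides.\<close>

lemma pair_closed_restrict:
  assumes "pair_closed \<Sigma> R1 R2 S"
  shows "pair_closed \<Sigma> R1 R2 (S \<inter> snd ` R1 \<times> snd ` R2)"
proof -
  have "list_all2 (\<lambda>u v. (u, v) \<in> S) us vs" if "list_all2 (\<lambda>u v. (u, v) \<in> S \<inter> T) us vs" for us vs T
    using that by (rule list_all2_mono) simp
  moreover have "(r1, r2) \<in> snd ` R1 \<times> snd ` R2" if "(l1, r1) \<in> R1" "(l2, r2) \<in> R2" for l1 r1 l2 r2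
    using that by force
  ultimately show ?thesis
    using pair_closedD[OF assms] by (intro pair_closedI) (metis IntD1 IntI)+
qed

lemma code_inter_iff:
  assumes "is_bta \<Sigma> C" "is_bta \<Sigma> D" "codes_bta c C" "codes_bta d D" "codes_set code_symbol m \<Sigma>"
  shows "code_inter m c d \<longleftrightarrow> lang \<Sigma> C \<inter> lang \<Sigma> D \<noteq> {}"
proof -
  have C: "codes_set code_symbol (code_finals c) (finals C)" "codes_set code_rule (code_rules c) (rules C)"
    and D: "codes_set code_symbol (code_finals d) (finals D)" "codes_set code_rule (code_rules d) (rules D)"
    using assms(3,4) by (auto simp: codes_bta_def code_finals_def code_rules_def)
  let ?final = "\<lambda>S. \<exists>a \<in> finals C. \<exists>b \<in> finals D. (const a, const b) \<in> S"
  let ?closed = "pair_closed \<Sigma> (rules C) (rules D)"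
  let ?rhs = "snd ` rules C \<times> snd ` rules D"
  let ?B = "prod_encode (code_rules c, code_rules d)"
  have "code_inter m c d \<longleftrightarrow> (\<forall>s < 2 ^ ?B. ?closed (decode_pairs s) \<longrightarrow> ?final (decode_pairs s))"
    unfolding code_inter_def code_closed_iff[OF assms(5) C(2) D(2)]
      C(1)[THEN codes_set_list_decode] D(1)[THEN codes_set_list_decode]
    by (simp add: decode_pairs_def code_trm_Fun del: code_trm.simps)
  also have "\<dots> \<longleftrightarrow> (\<forall>S \<subseteq> ?rhs. ?closed S \<longrightarrow> ?final S)"
  proof (intro iffI allI impI)
    fix S assume *: "\<forall>s < 2 ^ ?B. ?closed (decode_pairs s) \<longrightarrow> ?final (decode_pairs s)"
      and S: "S \<subseteq> ?rhs" "?closed S"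
    let ?A = "(\<lambda>(u, v). prod_encode (code_trm u, code_trm v)) ` S"
    have A: "?A \<subseteq> {..<?B}"
      using S(1) code_rhs_less[OF C(2)] code_rhs_less[OF D(2)] by (fastforce intro: prod_encode_less)
    then have "finite ?A" by (rule finite_subset) simp
    then have "decode_pairs (set_encode ?A) = S"
      by (auto simp: decode_pairs_def)
    with * S(2) set_encode_less[OF A] show "?final S" by metis
  next
    fix s assume *: "\<forall>S \<subseteq> ?rhs. ?closed S \<longrightarrow> ?final S" and "?closed (decode_pairs s)"
    then have "?final (decode_pairs s \<inter> ?rhs)"
      using pair_closed_restrict by (metis inf_le2)
    then show "?final (decode_pairs s)" by blast
  qed
  also have "\<dots> \<longleftrightarrow> lang \<Sigma> C \<inter> lang \<Sigma> D \<noteq> {}"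
    by (rule lang_inter_nonempty_iff[OF assms(1,2), symmetric])
  finally show ?thesis .
qed

text \<open>The code itself serves as a bound on the variables, so they need not be
  computed.\<close>

lemma vars_le_code_trm: "x \<in> vars t \<Longrightarrow> x \<le> code_trm t"
proof (induction t)
  case (Fun f ts)
  then obtain t where t: "t \<in> set ts" "x \<le> code_trm t" by auto
  then have "code_trm t < list_encode (map code_trm ts)" by (intro less_list_encode) simp
  also have "\<dots> \<le> prod_encode (code_symbol f, list_encode (map code_trm ts))" by (rule le_prod_encode_2)
  finally show ?case using t(2) by (simp add: sum_encode_def)
qed (simp add: sum_encode_def)

section \<open>Freezing on codes\<close>

text \<open>The recursion runs over terms and argument lists simultaneously: the first component of
  the value at \<open>n\<close> treats \<open>n\<close> as the code of a term, the second as the code of a list of terms.\<close>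

definition freeze_step :: "nat \<Rightarrow> nat \<Rightarrow> nat \<Rightarrow> nat" where
  "freeze_step N n h = prod_encode
     (if odd n
      then Suc (2 * prod_encode (code_root n, snd (prod_decode (code_nth h (n - Suc (code_args n))))))
      else Suc (2 * prod_encode (prod_encode (N + n div 2, 0), 0)),
      if n = 0 then 0
      else Suc (prod_encode
        (fst (prod_decode (code_nth h (n - Suc (fst (prod_decode (n - 1)))))),
         snd (prod_decode (code_nth h (n - Suc (snd (prod_decode (n - 1)))))))))"

definition freeze_pair :: "nat \<Rightarrow> nat \<Rightarrow> nat \<times> nat" where
  "freeze_pair N n = prod_decode (freeze_step N n (history (freeze_step N) n))"

lemma computable_freeze_pair [computable_intros]:
  assumes "computable f"
  shows "computable (\<lambda>xs. fst (freeze_pair N (f xs)))"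
proof -
  have step: "computable (\<lambda>xs. freeze_step N (arg 0 xs) (arg 1 xs))"
    unfolding freeze_step_def by (intro computable_intros)
  then have "computable (\<lambda>xs. freeze_step N (f xs) (history (freeze_step N) (f xs)))"
    by (rule computable_subst2[OF _ assms computable_history[OF step assms]])
  then show ?thesis unfolding freeze_pair_def by (rule computable_prod_decode)
qed

lemma freeze_pair_lookup:
  "i < n \<Longrightarrow> prod_decode (code_nth (history (freeze_step N) n) (n - Suc i)) = freeze_pair N i"
  by (simp add: code_nth_history freeze_pair_def)

text \<open>The argument list has a smaller code than the term, so its value is already in the
  history.\<close>

lemma freeze_pair_Fun:
  "fst (freeze_pair N (Suc (2 * prod_encode (f, l)))) = Suc (2 * prod_encode (f, snd (freeze_pair N l)))"
proof -
  have "l < Suc (2 * prod_encode (f, l))"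
    using le_prod_encode_2[of l f] by simp
  from freeze_pair_lookup[OF this, of N] show ?thesis
    by (subst freeze_pair_def) (simp add: freeze_step_def)
qed

lemma freeze_pair_Cons:
  "snd (freeze_pair N (Suc (prod_encode (a, l)))) =
     Suc (prod_encode (fst (freeze_pair N a), snd (freeze_pair N l)))"
proof -
  have "a < Suc (prod_encode (a, l))" "l < Suc (prod_encode (a, l))"
    using le_prod_encode_1[of a l] le_prod_encode_2[of l a] by simp_all
  from this[THEN freeze_pair_lookup, of N] show ?thesis
    by (subst freeze_pair_def) (simp add: freeze_step_def)
qed

lemma freeze_pair_code_trm: "fst (freeze_pair N (code_trm t)) = code_trm (freeze N t)"
proof (induction t)
  case (Var x)
  have "fst (freeze_pair N (2 * x)) = Suc (2 * prod_encode (prod_encode (N + x, 0), 0))"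
    by (simp add: freeze_pair_def freeze_step_def)
  then show ?case
    by (simp add: code_trm_Var code_trm_Fun freeze_def fresh_def del: code_trm.simps)
next
  case (Fun f ts)
  \<comment> \<open>Argument lists are handled by the second component, with an induction of their
    own.\<close>
  have "snd (freeze_pair N (list_encode (map code_trm ts))) = list_encode (map (\<lambda>t. code_trm (freeze N t)) ts)"
    using Fun.IH
  proof (induction ts)
    case Nil
    then show ?case by (simp add: freeze_pair_def freeze_step_def)
  qed (simp add: freeze_pair_Cons)
  then show ?case
    by (simp add: code_trm_Fun freeze_pair_Fun freeze_def comp_def del: code_trm.simps)
qed

text \<open>Each round of the recursion conses one fresh constant onto the list presenting the
  alphabet.\<close>

lemma codes_set_freeze_alphabet:
  assumes "codes_set code_symbol c \<Sigma>"
  shows "codes_set code_symbol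
    (rec_nat c (\<lambda>i m. Suc (prod_encode (prod_encode (N + i, 0), m))) k) (freeze_alphabet N k \<Sigma>)"
proof (induction k)
  case 0
  then show ?case using assms by (simp add: freeze_alphabet_def)
next
  case (Suc k)
  then obtain xs where xs: "set xs = freeze_alphabet N k \<Sigma>"
    "rec_nat c (\<lambda>i m. Suc (prod_encode (prod_encode (N + i, 0), m))) k = list_encode (map code_symbol xs)"
    by (auto simp: codes_set_def)
  then show ?case
    unfolding codes_set_def
    by (intro exI[of _ "fresh N k # xs"]) (auto simp: freeze_alphabet_def fresh_def lessThan_Suc)
qed

lemma symbols_subset: "t \<in> terms \<Sigma> \<Longrightarrow> symbols t \<subseteq> \<Sigma>"
  by (induction t) (force simp: terms_Fun_iff)+

theorem mainTheorem5:
  fixes \<Sigma> :: "symbol set" and R :: trs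
  assumes "ranked_alphabet \<Sigma>"
    and "trs \<Sigma> R"
    and "confluentp (rstep \<Sigma> R)"
    and "EPRF R"
  shows "decidable_on (terms \<Sigma>) (equivclp (rstep \<Sigma> R))"
proof -
  obtain F where F: "recursive 2 F"
    and EPRF: "\<And>\<Sigma> L m k. \<lbrakk>ranked_alphabet \<Sigma>; sign R \<subseteq> \<Sigma>; finite L; L \<subseteq> ground_terms \<Sigma>;
      codes_set code_symbol m \<Sigma>; codes_set code_trm k L\<rbrakk> \<Longrightarrow>
      \<exists>C. is_bta \<Sigma> C \<and> codes_bta (F [m, k]) C \<and> lang \<Sigma> C = descendants \<Sigma> R L"
    using assms(4) unfolding EPRF_def by metis
  \<comment> \<open>\<open>\<Sigma>\<close> is fixed, so its code and the bound on its names enter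
    the algorithm as constants.\<close>
  obtain c where c: "codes_set code_symbol c \<Sigma>"
    using finite_list[OF assms(1)] by (auto simp: codes_set_def)
  obtain N where N: "\<And>f. f \<in> \<Sigma> \<Longrightarrow> fst f < N"
    using finite_nat_set_iff_bounded[of "fst ` \<Sigma>"] assms(1) by auto
  define alphabet where
    "alphabet = (\<lambda>k. rec_nat c (\<lambda>i m. Suc (prod_encode (prod_encode (N + i, 0), m))) k)"
  define bta where "bta = (\<lambda>k p. F [alphabet k, Suc (prod_encode (fst (freeze_pair N p), 0))])"
  \<comment> \<open>On codes, \<open>Suc (p + q)\<close> exceeds every variable of both terms, so
    one alphabet serves both automata.\<close>
  define decide where "decide = (\<lambda>p q. code_inter (alphabet (Suc (p + q))) (bta (Suc (p + q)) p) (bta (Suc (p + q)) q))"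
  have alphabet: "computable (\<lambda>xs. alphabet (f xs))" if "computable f" for f
    unfolding alphabet_def using that by (intro computable_intros)
  have F': "computable (\<lambda>xs. F [f xs, g xs])" if "computable f" "computable g" for f g
    using computable_comp[of "[f, g]" F] F that by (simp add: numeral_2_eq_2)
  have "decidable (\<lambda>xs. decide (arg 0 xs) (arg 1 xs))"
    unfolding decide_def bta_def by (intro computable_intros alphabet F')
  then have "recursive 2 (\<lambda>xs. of_bool (decide (arg 0 xs) (arg 1 xs)))"
    by (simp add: decidable_def computable_def)
  moreover have "decide (code_trm p) (code_trm q) \<longleftrightarrow> equivclp (rstep \<Sigma> R) p q"
    if p: "p \<in> terms \<Sigma>" and q: "q \<in> terms \<Sigma>" for p q
  proof -
    define k where "k = Suc (code_trm p + code_trm q)"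
    let ?\<Delta> = "freeze_alphabet N k \<Sigma>"
    have k: "vars p \<subseteq> {..<k}" "vars q \<subseteq> {..<k}"
      using vars_le_code_trm by (force simp: k_def)+
    have "sign R \<subseteq> \<Sigma>"
      using assms(2) symbols_subset by (fastforce simp: trs_def sign_def)
    then have \<Delta>: "finite ?\<Delta>" "sign R \<subseteq> ?\<Delta>" "codes_set code_symbol (alphabet k) ?\<Delta>"
      using assms(1) codes_set_freeze_alphabet[OF c] by (auto simp: freeze_alphabet_def alphabet_def)
    have "\<exists>C. is_bta ?\<Delta> C \<and> codes_bta (bta k (code_trm t)) C \<and> lang ?\<Delta> C = descendants ?\<Delta> R {freeze N t}"
      if "t \<in> terms \<Sigma>" "vars t \<subseteq> {..<k}" for t
      unfolding bta_def freeze_pair_code_trm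
    proof (rule EPRF[OF \<Delta>(1,2) _ _ \<Delta>(3)])
      show "{freeze N t} \<subseteq> ground_terms ?\<Delta>"
        using freeze_in_terms[OF that] by (simp add: ground_terms_def)
      show "codes_set code_trm (Suc (prod_encode (code_trm (freeze N t), 0))) {freeze N t}"
        unfolding codes_set_def by (intro exI[of _ "[freeze N t]"]) simp
    qed simp
    from this[OF p k(1)] this[OF q k(2)] obtain C D where
      C: "is_bta ?\<Delta> C" "codes_bta (bta k (code_trm p)) C" "lang ?\<Delta> C = descendants ?\<Delta> R {freeze N p}" and
      D: "is_bta ?\<Delta> D" "codes_bta (bta k (code_trm q)) D" "lang ?\<Delta> D = descendants ?\<Delta> R {freeze N q}"
      by blast
    have "decide (code_trm p) (code_trm q) \<longleftrightarrow> lang ?\<Delta> C \<inter> lang ?\<Delta> D \<noteq> {}"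
      unfolding decide_def k_def[symmetric] by (rule code_inter_iff[OF C(1) D(1) C(2) D(2) \<Delta>(3)])
    also have "\<dots> \<longleftrightarrow> equivclp (rstep \<Sigma> R) p q"
      unfolding C(3) D(3) by (rule equivclp_iff_descendants[OF assms(2,3) N p q k, symmetric])
    finally show ?thesis .
  qed
  ultimately show ?thesis
    unfolding decidable_on_def
    by (intro exI[of _ "\<lambda>xs. of_bool (decide (arg 0 xs) (arg 1 xs))"]) (simp add: of_bool_def)
qed

end
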